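(* Let $\gamma \geq 0$ be an integer and $\mathcal{P}$ be a $\gamma$-pluriassociative algebra admitting a $b$-wire-unit $e$ for some $b \in [\gamma]$. Then (i) for all $a \in [b]$, the operations $\dashv_a$, $\dashv_b$, $\vdash_a$, and $\vdash_b$ of $\mathcal{P}$ are equal; (ii) $e$ is also an $a$-wire-unit for all $a \in [b]$; (iii) $e$ is the only wire-unit of $\mathcal{P}$; (iv) if $e'$ is an $a$-bar-unit for some $a \in [b]$, then $e' = e$.
   Context: The ground field has characteristic zero; $[n]=\{1,\dots,n\}$. A $\gamma$-pluriassociative algebra is a vector space with bilinear operations $\dashv_a, \vdash_a$, $a \in [\gamma]$, such that for all elements $x,y,z$ and all $a, a' \in [\gamma]$, with $a \uparrow a' := \max(a,a')$: $(x \vdash_{a'} y) \dashv_a z = x \vdash_{a'} (y \dashv_a z)$; $(x \dashv_{a\uparrow a'} y) \dashv_a z = x \dashv_a (y \vdash_{a'} z)$; $(x \dashv_{a'} y) \vdash_a z = x \vdash_a (y \vdash_{a \uparrow a'} z)$; $(x \dashv_a y) \dashv_{a\uparrow a'} z = x \dashv_a (y \dashv_{a'} z)$; $(x \vdash_{a'} y) \vdash_a z = x \vdash_{a \uparrow a'} (y \vdash_a z)$. For $a \in [\gamma]$, an element $e$ of $\mathcal{P}$ is an $a$-bar-unit if $x \dashv_a e = x = e \vdash_a x$ for all $x \in \mathcal{P}$, and an $a$-wire-unit if $e \dashv_a x = x = x \vdash_a e$ for all $x \in \mathcal{P}$. A wire-unit is an element that is an $a$-wire-unit for some $a \in [\gamma]$.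 *)

theory Defs
  imports Complex_Main
begin

definition bilinear_op ::
  "('k::field \<Rightarrow> 'v::ab_group_add \<Rightarrow> 'v) \<Rightarrow> ('v \<Rightarrow> 'v \<Rightarrow> 'v) \<Rightarrow> bool" where
  "bilinear_op scale f \<longleftrightarrow>
     (\<forall>y. Vector_Spaces.linear scale scale (\<lambda>x. f x y)) \<and>
     (\<forall>x. Vector_Spaces.linear scale scale (\<lambda>y. f x y))"

text \<open>
  The underlying vector space is the whole type \<open>'v\<close>. The families of operations are
  indexed by all natural numbers, but only the values at indices in \<open>{1..\<gamma>}\<close> matter:
  \<open>lop a x y\<close> is $x \dashv_a y$ and \<open>rop a x y\<close> is $x \vdash_a y$.
\<close>

locale pluriassociative_algebra = vector_space scale
  for scale :: "'k::field_char_0 \<Rightarrow> 'v::ab_group_add \<Rightarrow> 'v" +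
  fixes \<gamma> :: nat
    and lop rop :: "nat \<Rightarrow> 'v \<Rightarrow> 'v \<Rightarrow> 'v"
  assumes bilinear_lop: "a \<in> {1..\<gamma>} \<Longrightarrow> bilinear_op scale (lop a)"
    and bilinear_rop: "a \<in> {1..\<gamma>} \<Longrightarrow> bilinear_op scale (rop a)"
    and rop_lop: "\<lbrakk>a \<in> {1..\<gamma>}; a' \<in> {1..\<gamma>}\<rbrakk> \<Longrightarrow>
      lop a (rop a' x y) z = rop a' x (lop a y z)"
    and lop_lop_rop: "\<lbrakk>a \<in> {1..\<gamma>}; a' \<in> {1..\<gamma>}\<rbrakk> \<Longrightarrow>
      lop a (lop (max a a') x y) z = lop a x (rop a' y z)"
    and lop_rop_rop: "\<lbrakk>a \<in> {1..\<gamma>}; a' \<in> {1..\<gamma>}\<rbrakk> \<Longrightarrow>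
      rop a (lop a' x y) z = rop a x (rop (max a a') y z)"
    and lop_lop: "\<lbrakk>a \<in> {1..\<gamma>}; a' \<in> {1..\<gamma>}\<rbrakk> \<Longrightarrow>
      lop (max a a') (lop a x y) z = lop a x (lop a' y z)"
    and rop_rop: "\<lbrakk>a \<in> {1..\<gamma>}; a' \<in> {1..\<gamma>}\<rbrakk> \<Longrightarrow>
      rop a (rop a' x y) z = rop (max a a') x (rop a y z)"

definition bar_unit_at ::
  "(nat \<Rightarrow> 'v \<Rightarrow> 'v \<Rightarrow> 'v) \<Rightarrow> (nat \<Rightarrow> 'v \<Rightarrow> 'v \<Rightarrow> 'v) \<Rightarrow> nat \<Rightarrow> 'v \<Rightarrow> bool" where
  "bar_unit_at lop rop a e \<longleftrightarrow> (\<forall>x. lop a x e = x \<and> rop a e x = x)"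

definition wire_unit_at ::
  "(nat \<Rightarrow> 'v \<Rightarrow> 'v \<Rightarrow> 'v) \<Rightarrow> (nat \<Rightarrow> 'v \<Rightarrow> 'v \<Rightarrow> 'v) \<Rightarrow> nat \<Rightarrow> 'v \<Rightarrow> bool" where
  "wire_unit_at lop rop a e \<longleftrightarrow> (\<forall>x. lop a e x = x \<and> rop a x e = x)"

definition wire_unit ::
  "nat \<Rightarrow> (nat \<Rightarrow> 'v \<Rightarrow> 'v \<Rightarrow> 'v) \<Rightarrow> (nat \<Rightarrow> 'v \<Rightarrow> 'v \<Rightarrow> 'v) \<Rightarrow> 'v \<Rightarrow> bool" where
  "wire_unit \<gamma> lop rop e \<longleftrightarrow> (\<exists>a\<in>{1..\<gamma>}. wire_unit_at lop rop a e)"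

end

theory Submission
  imports Defs
begin

text \<open>
  Putting the wire-unit first in \<open>lop b (lop b x y) z = lop b x (rop a y z)\<close> identifies
  $\dashv_b$ with every $\vdash_a$, $a \le b$; putting it last in the mirror axiom identifies
  $\vdash_b$ with every $\dashv_a$. All these operations are then one and the same, and uniqueness
  is uniqueness of two-sided units.
\<close>

context pluriassociative_algebra
begin

lemma wire_unit_at_imp_ops_eq:
  assumes "b \<in> {1..\<gamma>}" "wire_unit_at lop rop b e" "a \<in> {1..b}"
  shows "lop a = rop b" "rop a = rop b"
proof -
  have unit: "lop b e x = x" "rop b x e = x" for x
    using assms(2) by (auto simp: wire_unit_at_def)
  have lop_eq: "lop c = rop b" and rop_eq: "rop c = lop b" if "c \<in> {1..b}" for c
  proof -
    \<comment> \<open>Since c \<le> b, the maximum in the axioms collapses to b, so every occurrence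
      of e below meets an operation of index b, where it acts as a unit.\<close>
    have c: "c \<in> {1..\<gamma>}" "max b c = b"
      using assms(1) that by auto
    show "lop c = rop b"
      using lop_rop_rop[OF assms(1) c(1), of _ _ e] by (simp add: fun_eq_iff c(2) unit)
    show "rop c = lop b"
      using lop_lop_rop[OF assms(1) c(1), of e] by (simp add: fun_eq_iff c(2) unit)
  qed
  \<comment> \<open>The case c = b links the two identifications:
    \<open>rop a = lop b = rop b\<close>.\<close>
  have b: "b \<in> {1..b}"
    using assms(1) by simp
  show "lop a = rop b" "rop a = rop b"
    by (rule lop_eq[OF assms(3)], rule trans[OF rop_eq[OF assms(3)] lop_eq[OF b]])
qed

lemma wire_unit_at_le:
  assumes "b \<in> {1..\<gamma>}" "wire_unit_at lop rop b e" "a \<in> {1..b}"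
  shows "wire_unit_at lop rop a e"
proof -
  have "b \<in> {1..b}"
    using assms(1) by simp
  then have "lop a = lop b" "rop a = rop b"
    using wire_unit_at_imp_ops_eq[OF assms] wire_unit_at_imp_ops_eq[OF assms(1,2), of b] by simp_all
  with assms(2) show ?thesis
    by (simp add: wire_unit_at_def)
qed

text \<open>The two indices may differ, so both elements are first brought down to a common index c.
  There \<open>lop c = rop c\<close>, and the product of e and e' is e' because e is a left unit for
  \<open>lop c\<close>, and e because e' is a right unit for \<open>rop c\<close>.\<close>

lemma wire_unit_at_unique:
  assumes "a \<in> {1..\<gamma>}" "b \<in> {1..\<gamma>}" "wire_unit_at lop rop a e" "wire_unit_at lop rop b e'"
  shows "e = e'"
proof -
  define c where "c = min a b"
  have c: "c \<in> {1..a}" "c \<in> {1..b}"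
    using assms(1,2) by (auto simp: c_def)
  have "wire_unit_at lop rop c e" "wire_unit_at lop rop c e'"
    using wire_unit_at_le[OF assms(1,3) c(1)] wire_unit_at_le[OF assms(2,4) c(2)] by simp_all
  moreover have "lop c = rop c"
    using wire_unit_at_imp_ops_eq[OF assms(1,3) c(1)] by simp
  ultimately show ?thesis
    by (metis wire_unit_at_def)
qed

text \<open>Evaluate \<open>lop a e e'\<close> twice: e is a wire-unit at a as well, which gives e',
  while the bar-unit e' on the right gives e.\<close>

lemma bar_unit_at_eq_wire_unit:
  assumes "b \<in> {1..\<gamma>}" "wire_unit_at lop rop b e" "a \<in> {1..b}" "bar_unit_at lop rop a e'"
  shows "e' = e"
  using wire_unit_at_le[OF assms(1-3)] assms(4) by (metis bar_unit_at_def wire_unit_at_def)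

end

theorem proposition3p2p1:
  fixes scale :: "'k::field_char_0 \<Rightarrow> 'v::ab_group_add \<Rightarrow> 'v"
    and \<gamma> b :: nat
    and lop rop :: "nat \<Rightarrow> 'v \<Rightarrow> 'v \<Rightarrow> 'v"
    and e :: 'v
  assumes "pluriassociative_algebra scale \<gamma> lop rop"
    and "b \<in> {1..\<gamma>}"
    and "wire_unit_at lop rop b e"
  shows "(\<forall>a\<in>{1..b}. lop a = lop b \<and> lop b = rop a \<and> rop a = rop b)
    \<and> (\<forall>a\<in>{1..b}. wire_unit_at lop rop a e)
    \<and> (\<forall>e'. wire_unit \<gamma> lop rop e' \<longleftrightarrow> e' = e)
    \<and> (\<forall>a\<in>{1..b}. \<forall>e'. bar_unit_at lop rop a e' \<longrightarrow> e' = e)"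
proof -
  interpret pluriassociative_algebra scale \<gamma> lop rop
    by (fact assms(1))
  \<comment> \<open>All operations are compared with \<open>rop b\<close>; the instance at b itself
    supplies \<open>lop b = rop b\<close>.\<close>
  have "b \<in> {1..b}"
    using assms(2) by simp
  then have "\<forall>a\<in>{1..b}. lop a = lop b \<and> lop b = rop a \<and> rop a = rop b"
    using wire_unit_at_imp_ops_eq[OF assms(2,3)] by metis
  moreover have "\<forall>a\<in>{1..b}. wire_unit_at lop rop a e"
    by (intro ballI wire_unit_at_le[OF assms(2,3)])
  moreover have "wire_unit \<gamma> lop rop e' \<longleftrightarrow> e' = e" for e'
  proof
    assume "wire_unit \<gamma> lop rop e'"
    then obtain a where "a \<in> {1..\<gamma>}" "wire_unit_at lop rop a e'"
      unfolding wire_unit_def by (rule bexE)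
    then show "e' = e"
      using assms(2,3) by (intro wire_unit_at_unique)
  next
    assume "e' = e"
    then show "wire_unit \<gamma> lop rop e'"
      unfolding wire_unit_def using assms(2,3) by (intro bexI[of _ b]) simp_all
  qed
  moreover have "\<forall>a\<in>{1..b}. \<forall>e'. bar_unit_at lop rop a e' \<longrightarrow> e' = e"
    by (intro ballI allI impI bar_unit_at_eq_wire_unit[OF assms(2,3)])
  ultimately show ?thesis
    by (intro conjI allI)
qed

end
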